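(* Let $M$ be a finite nonempty set of primes and let $x$ be a positive real number. Let $T_M(x)$ be the number of positive integers $a\le x$ such that neither $a-1$ nor $a+1$ is divisible by any prime in $M$. Then $$T_M(x) = [x] - \sum D_{\{p_i\}}(x) + \sum D_{\{p_i,p_j\}}(x) - \sum D_{\{p_i,p_j,p_k\}}(x) + \cdots + (-1)^{|M|} D_{M}(x),$$ where the sums are taken over all one-element subsets, then all two-element subsets, three-element subsets, etc. of $M$; equivalently, $$T_M(x) = [x] + \sum_{\emptyset\ne S\subseteq M} (-1)^{|S|} D_S(x).$$
   Context: $[y]$ denotes the integer part (floor) of the real number $y$. For a finite nonempty set $S$ of primes, put $P_S=\prod_{p\in S}p$. The set of discarded $S$-prime centers $D_S$ is the set of integers $z$ with $0\le z\le P_S$ such that every $p\in S$ divides $z-1$ or $z+1$. For a positive real number $x$, $$D_S(x)=\sum_{z\in D_S}\left[\frac{x+z}{P_S}\right].$$ The divisibility convention is that $0$ is divisible by every prime. *)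

theory Defs
  imports Complex_Main "HOL-Computational_Algebra.Primes"
begin

definition prime_prod :: "nat set \<Rightarrow> nat" where
  "prime_prod S = (\<Prod>p\<in>S. p)"

(* Working over the integers avoids truncated subtraction in z - 1 (for z = 0). *)
definition discarded_centers :: "nat set \<Rightarrow> int set" where
  "discarded_centers S =
     {z. 0 \<le> z \<and> z \<le> int (prime_prod S) \<and> (\<forall>p\<in>S. int p dvd z - 1 \<or> int p dvd z + 1)}"

definition discarded_sum :: "nat set \<Rightarrow> real \<Rightarrow> int" where
  "discarded_sum S x =
     (\<Sum>z\<in>discarded_centers S. \<lfloor>(x + real_of_int z) / real (prime_prod S)\<rfloor>)"

definition surviving_count :: "nat set \<Rightarrow> real \<Rightarrow> nat" where
  "surviving_count M x =
     card {a :: int. 0 < a \<and> real_of_int a \<le> x \<and>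
             (\<forall>p\<in>M. \<not> int p dvd a - 1 \<and> \<not> int p dvd a + 1)}"

end

theory Submission
  imports Defs "HOL-Library.FuncSet"
begin

text \<open>
  For an integer \<open>a\<close> let \<open>B(a)\<close> be the set of primes in \<open>M\<close> dividing \<open>a - 1\<close> or \<open>a + 1\<close>.
  Inclusion-exclusion over the primes (\<open>count_avoiding_all\<close>) writes the surviving count as the
  sum of \<open>(-1) ^ card S * N(S)\<close> over all \<open>S \<subseteq> M\<close>, where \<open>N(S)\<close> counts the integers \<open>a\<close> in
  \<open>(0, x]\<close> with \<open>S \<subseteq> B(a)\<close>. The empty set contributes \<open>\<lfloor>x\<rfloor>\<close>.

  For nonempty \<open>S\<close> the count \<open>N(S)\<close> is the discarded sum (\<open>discarded_sum_eq_card\<close>): the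
  condition \<open>S \<subseteq> B(a)\<close> is invariant under \<open>a \<mapsto> -a\<close> and under translation by the product \<open>P\<close> of
  \<open>S\<close>, so each such \<open>a\<close> is uniquely \<open>k * P - z\<close> for a discarded center \<open>z\<close> and some
  \<open>k \<ge> 1\<close>, and \<open>k * P - z \<le> x\<close> holds exactly for \<open>k \<le> \<lfloor>(x + z) / P\<rfloor>\<close>.
\<close>

text \<open>
  The expansion over \<open>S \<subseteq> M\<close> of \<open>\<Prod>p\<in>M. 1 - of_bool (Q p a)\<close>, the indicator of \<open>a\<close> avoiding
  every property, summed over \<open>a \<in> X\<close>.
\<close>

lemma count_avoiding_all:
  fixes Q :: "'i \<Rightarrow> 'a \<Rightarrow> bool"
  assumes "finite X" and "finite M"
  shows "int (card {a\<in>X. \<forall>p\<in>M. \<not> Q p a}) =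
           (\<Sum>S\<in>Pow M. (-1) ^ card S * int (card {a\<in>X. \<forall>p\<in>S. Q p a}))"
proof -
  have prod_of_bool: "(\<Prod>p\<in>S. of_bool (R p)) = (of_bool (\<forall>p\<in>S. R p) :: int)"
    if "finite S" for S and R :: "'i \<Rightarrow> bool"
    using that by (induction S rule: finite_induct) auto
  have card_eq: "int (card {a\<in>X. R a}) = (\<Sum>a\<in>X. of_bool (R a))" for R
    using assms(1) by (simp add: sum.If_cases of_bool_def Int_def)
  have expand: "of_bool (\<forall>p\<in>M. \<not> Q p a) =
      (\<Sum>S\<in>Pow M. (-1) ^ card S * of_bool (\<forall>p\<in>S. Q p a) :: int)" for a
  proof -
    have "of_bool (\<forall>p\<in>M. \<not> Q p a) = (\<Prod>p\<in>M. 1 - of_bool (Q p a) :: int)"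
      unfolding prod_of_bool[OF assms(2), symmetric] by (intro prod.cong) auto
    also have "\<dots> = (\<Sum>S\<in>Pow M. (-1) ^ card S * (\<Prod>p\<in>S. of_bool (Q p a)))"
      using prod_diff_conv_sum[OF assms(2), of "\<lambda>_. 1 :: int"] by simp
    also have "\<dots> = (\<Sum>S\<in>Pow M. (-1) ^ card S * of_bool (\<forall>p\<in>S. Q p a))"
      using assms(2) by (intro sum.cong refl) (auto simp: prod_of_bool finite_subset)
    finally show ?thesis .
  qed
  show ?thesis
    unfolding card_eq expand sum_distrib_left by (rule sum.swap)
qed

lemma dvd_neighbour_reflect:
  fixes d a m :: int
  assumes "d dvd m"
  shows "d dvd (m - a) - 1 \<or> d dvd (m - a) + 1 \<longleftrightarrow> d dvd a - 1 \<or> d dvd a + 1"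
proof -
  have "d dvd (m - a) - 1 \<longleftrightarrow> d dvd a + 1"
    using dvd_diff_right_iff[of d m "a + 1"] assms by (simp add: algebra_simps)
  moreover have "d dvd (m - a) + 1 \<longleftrightarrow> d dvd a - 1"
    using dvd_diff_right_iff[of d m "a - 1"] assms by (simp add: algebra_simps)
  ultimately show ?thesis
    by blast
qed

lemma discarded_center_bounds:
  assumes "finite S" and "S \<noteq> {}" and "\<forall>p\<in>S. prime p" and "z \<in> discarded_centers S"
  shows "0 < z" and "z < int (prime_prod S)"
proof -
  obtain p where p: "p \<in> S" "prime p"
    using assms by auto
  then have not_unit: "\<not> int p dvd 1"
    by auto
  have dvd: "int p dvd int (prime_prod S)"
    using p assms(1) unfolding prime_prod_def of_nat_dvd_iff by (intro dvd_prodI)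
  have z: "0 \<le> z" "z \<le> int (prime_prod S)" "int p dvd z - 1 \<or> int p dvd z + 1"
    using assms(4) p by (auto simp: discarded_centers_def)
  have "\<not> int p dvd z"
    using z(3) not_unit by (auto simp: dvd_diff_right_iff dvd_add_right_iff)
  then show "0 < z" and "z < int (prime_prod S)"
    using z dvd by (auto simp: order_less_le)
qed

text \<open>
  Although centers range over a closed interval of length \<open>P\<close>, they represent each residue class
  modulo \<open>P\<close> at most once: the endpoints 0 and \<open>P\<close> are divisible by every \<open>p \<in> S\<close> and hence are not
  centers. Since \<open>0 < z < P\<close>, moreover, \<open>k * P - z > 0\<close> is equivalent to \<open>k \<ge> 1\<close>.
\<close>

lemma discarded_sum_eq_card:
  assumes "finite S" and "S \<noteq> {}" and "\<forall>p\<in>S. prime p" and "x > 0"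
  shows "discarded_sum S x =
           int (card {a \<in> {0<..\<lfloor>x\<rfloor>}. \<forall>p\<in>S. int p dvd a - 1 \<or> int p dvd a + 1})"
proof -
  define P where "P = int (prime_prod S)"
  define D where "D = discarded_centers S"
  define K where "K z = {1..\<lfloor>(x + real_of_int z) / P\<rfloor>}" for z :: int
  define A where "A = {a \<in> {0<..\<lfloor>x\<rfloor>}. \<forall>p\<in>S. int p dvd a - 1 \<or> int p dvd a + 1}"
  have "P > 0"
    using assms by (auto simp: P_def prime_prod_def intro!: prod_pos prime_gt_0_nat)
  have dvd_P: "int p dvd P" if "p \<in> S" for p
    using that assms(1) unfolding P_def prime_prod_def of_nat_dvd_iff by (intro dvd_prodI)
  have D_bounds: "0 < z" "z < P" if "z \<in> D" for z
    using discarded_center_bounds[OF assms(1-3)] that by (auto simp: D_def P_def)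
  have "D \<subseteq> {0..P}"
    by (auto simp: D_def discarded_centers_def P_def)
  then have "finite D"
    using finite_subset by blast
  have le_iff: "k \<le> \<lfloor>(x + real_of_int z) / P\<rfloor> \<longleftrightarrow> k * P - z \<le> \<lfloor>x\<rfloor>" for k z :: int
  proof -
    have "k \<le> \<lfloor>(x + real_of_int z) / P\<rfloor> \<longleftrightarrow> real_of_int (k * P - z) \<le> x"
      using \<open>P > 0\<close> by (simp add: le_floor_iff pos_le_divide_eq algebra_simps)
    then show ?thesis
      by (simp only: le_floor_iff)
  qed
  have "bij_betw (\<lambda>(z, k). k * P - z) (Sigma D K) A"
  proof (rule bij_betwI[where g = "\<lambda>a. ((- a) mod P, (a + (- a) mod P) div P)"])
    show "(\<lambda>(z, k). k * P - z) \<in> Sigma D K \<rightarrow> A"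
    proof clarify
      fix z k assume z: "z \<in> D" and k: "k \<in> K z"
      have "P \<le> k * P"
        using k \<open>P > 0\<close> by (simp add: K_def)
      then have "0 < k * P - z"
        using D_bounds[OF z] by linarith
      moreover have "\<forall>p\<in>S. int p dvd (k * P - z) - 1 \<or> int p dvd (k * P - z) + 1"
        using z dvd_P by (simp add: dvd_neighbour_reflect D_def discarded_centers_def)
      ultimately show "k * P - z \<in> A"
        using k le_iff by (auto simp: A_def K_def)
    qed
    show "(\<lambda>a. ((- a) mod P, (a + (- a) mod P) div P)) \<in> A \<rightarrow> Sigma D K"
    proof
      fix a assume a: "a \<in> A"
      define z where "z = (- a) mod P"
      define k where "k = (a + z) div P"
      have z: "0 \<le> z" "z < P"
        using \<open>P > 0\<close> by (auto simp: z_def)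
      have "P dvd a + z"
        unfolding z_def by (simp add: dvd_eq_mod_eq_0 mod_simps)
      then have kP: "k * P = a + z"
        by (simp add: k_def)
      then have z_eq: "z = k * P - a"
        by simp
      have "\<forall>p\<in>S. int p dvd z - 1 \<or> int p dvd z + 1"
        unfolding z_eq using a dvd_P by (simp add: dvd_neighbour_reflect A_def)
      then have "z \<in> D"
        using z by (auto simp: D_def discarded_centers_def P_def)
      moreover have "0 < k * P"
        using kP a z by (auto simp: A_def)
      then have "1 \<le> k"
        using \<open>P > 0\<close> by (simp add: zero_less_mult_iff)
      then have "k \<in> K z"
        using le_iff[of k z] kP a by (simp add: K_def A_def)
      ultimately show "((- a) mod P, (a + (- a) mod P) div P) \<in> Sigma D K"
        by (simp add: z_def k_def)
    qed
    show "((- (case u of (z, k) \<Rightarrow> k * P - z)) mod P,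
        ((case u of (z, k) \<Rightarrow> k * P - z) + (- (case u of (z, k) \<Rightarrow> k * P - z)) mod P) div P) = u"
      if "u \<in> Sigma D K" for u
    proof -
      obtain z k where u: "u = (z, k)" "z \<in> D"
        using \<open>u \<in> Sigma D K\<close> by auto
      have "(- (k * P - z)) mod P = z mod P"
        using mod_mult_self1[of z "- k" P] by (simp add: algebra_simps)
      also have "\<dots> = z"
        using D_bounds[OF u(2)] by simp
      finally show ?thesis
        using u \<open>P > 0\<close> by simp
    qed
    show "(case ((- a) mod P, (a + (- a) mod P) div P) of (z, k) \<Rightarrow> k * P - z) = a" for a
    proof -
      have "P dvd a + (- a) mod P"
        by (simp add: dvd_eq_mod_eq_0 mod_simps)
      then show ?thesis
        by simp
    qed
  qed
  then have "card A = card (Sigma D K)"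
    by (simp add: bij_betw_same_card)
  also have "\<dots> = (\<Sum>z\<in>D. card (K z))"
    using \<open>finite D\<close> by (simp add: K_def)
  finally have "int (card A) = (\<Sum>z\<in>D. int (card (K z)))"
    by simp
  also have "\<dots> = discarded_sum S x"
    unfolding discarded_sum_def D_def[symmetric]
  proof (rule sum.cong)
    fix z assume "z \<in> D"
    then have "0 \<le> \<lfloor>(x + real_of_int z) / P\<rfloor>"
      using D_bounds[of z] \<open>P > 0\<close> \<open>x > 0\<close> by simp
    then show "int (card (K z)) = \<lfloor>(x + real_of_int z) / real (prime_prod S)\<rfloor>"
      by (simp add: K_def P_def)
  qed simp
  finally show ?thesis
    by (simp add: A_def)
qed

lemma sum_nonempty_subsets_by_card:
  assumes "finite M"
  shows "(\<Sum>S\<in>{S. S \<subseteq> M \<and> S \<noteq> {}}. f (card S) * g S) =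
           (\<Sum>k=1..card M. f k * (\<Sum>S\<in>{S. S \<subseteq> M \<and> card S = k}. g S :: int))"
proof -
  let ?N = "{S. S \<subseteq> M \<and> S \<noteq> {}}"
  have "card ` ?N \<subseteq> {1..card M}"
    using assms by (auto simp: Suc_le_eq card_gt_0_iff finite_subset card_mono)
  then have "(\<Sum>S\<in>?N. f (card S) * g S) =
      (\<Sum>k=1..card M. \<Sum>S\<in>{S \<in> ?N. card S = k}. f (card S) * g S)"
    using assms by (intro sum.group[symmetric]) auto
  also have "\<dots> = (\<Sum>k=1..card M. f k * (\<Sum>S\<in>{S. S \<subseteq> M \<and> card S = k}. g S))"
    unfolding sum_distrib_left by (intro sum.cong) auto
  finally show ?thesis .
qed

theorem mainTheorem2:
  fixes M :: "nat set" and x :: real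
  assumes "finite M" and "M \<noteq> {}" and "\<forall>p\<in>M. prime p" and "x > 0"
  shows "int (surviving_count M x) =
           \<lfloor>x\<rfloor> + (\<Sum>k=1..card M. (-1) ^ k * (\<Sum>S\<in>{S. S \<subseteq> M \<and> card S = k}. discarded_sum S x))
       \<and> int (surviving_count M x) =
           \<lfloor>x\<rfloor> + (\<Sum>S\<in>{S. S \<subseteq> M \<and> S \<noteq> {}}. (-1) ^ card S * discarded_sum S x)"
proof -
  let ?X = "{0<..\<lfloor>x\<rfloor>}"
  let ?Q = "\<lambda>p a. int p dvd a - 1 \<or> int p dvd a + 1"
  let ?N = "{S. S \<subseteq> M \<and> S \<noteq> {}}"
  have "surviving_count M x = card {a\<in>?X. \<forall>p\<in>M. \<not> ?Q p a}"
    unfolding surviving_count_def by (rule arg_cong[where f = card]) (auto simp: le_floor_iff)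
  then have "int (surviving_count M x) =
      (\<Sum>S\<in>Pow M. (-1) ^ card S * int (card {a\<in>?X. \<forall>p\<in>S. ?Q p a}))"
    using count_avoiding_all[of ?X M ?Q] assms(1) by simp
  also have "Pow M = insert {} ?N"
    by auto
  also have "(\<Sum>S\<in>insert {} ?N. (-1) ^ card S * int (card {a\<in>?X. \<forall>p\<in>S. ?Q p a})) =
      \<lfloor>x\<rfloor> + (\<Sum>S\<in>?N. (-1) ^ card S * int (card {a\<in>?X. \<forall>p\<in>S. ?Q p a}))"
    using assms(1,4) by (subst sum.insert) (auto simp flip: greaterThanAtMost_iff)
  also have "(\<Sum>S\<in>?N. (-1) ^ card S * int (card {a\<in>?X. \<forall>p\<in>S. ?Q p a})) =
      (\<Sum>S\<in>?N. (-1) ^ card S * discarded_sum S x)"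
  proof (rule sum.cong)
    fix S assume "S \<in> ?N"
    then have "finite S" "S \<noteq> {}" "\<forall>p\<in>S. prime p"
      using assms finite_subset by auto
    then show "(-1) ^ card S * int (card {a\<in>?X. \<forall>p\<in>S. ?Q p a}) =
        (-1) ^ card S * discarded_sum S x"
      using discarded_sum_eq_card assms(4) by simp
  qed simp
  finally have subsets: "int (surviving_count M x) =
      \<lfloor>x\<rfloor> + (\<Sum>S\<in>?N. (-1) ^ card S * discarded_sum S x)" .
  then show ?thesis
    using sum_nonempty_subsets_by_card[OF assms(1), of "\<lambda>k. (-1) ^ k" "\<lambda>S. discarded_sum S x"]
    by simp
qed

end
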